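(* Let $r\ge0$. For every $D\in\mathcal D_n$ and every decision $\bar z$ with $L(\bar z,\bar y)<\infty$ for all $(\bar x,\bar y)\in\Omega_n$, the bootstrap robust Nadaraya-Watson cost ($k(n)=n$) $$c_n(\bar z,D,x_0)=\sup\{\mathrm E^n_{D'}[L(\bar z,y)\mid x=x_0]:\ D'\in\mathcal D_n,\ B(D',D)\le r\}$$ equals the optimal value of the (dual) convex optimization problem $$\begin{array}{rl}\inf&\alpha\\ \text{s.t.}&\alpha\in\mathbb R,\ \nu\in\mathbb R_+,\\ &\nu\log\Big(\sum_{(\bar x,\bar y)\in\Omega_n}\exp\big((L(\bar z,\bar y)-\alpha)\,w_n(\bar x,x_0)/\nu\big)\,D[\bar x,\bar y]\Big)+r\,\nu\le0.\end{array}$$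
   Context: Data. Let $\bar d_1=(\bar x_1,\bar y_1),\dots,\bar d_n=(\bar x_n,\bar y_n)$ be a fixed finite list (training data, $n\ge1$) of points in $\Omega\subseteq\mathbb R^{\dim(x)}\times\mathbb R^{\dim(y)}$, $\Omega_n$ the finite set of distinct points in the list, and $\mathcal D_n$ the set of all probability distributions on $\Omega_n$. Fix a context of interest $x_0\in\mathbb R^{\dim(x)}$. $w_n(\bar x,x_0)>0$ is a positive weighing function. $L(z,\bar y)\in\mathbb R_+\cup\{+\infty\}$ is convex in the decision $z\in\mathbb R^{\dim(z)}$ for each $\bar y$ and measurable in $\bar y$ for each $z$. Nadaraya-Watson estimator (the case $k(n)=n$, all observations are used): for $D\in\mathcal D_n$, $$\mathrm E^n_D[L(z,y)\mid x=x_0]=\frac{\sum_{(\bar x,\bar y)\in\Omega_n}L(z,\bar y)\,w_n(\bar x,x_0)\,D[\bar x,\bar y]}{\sum_{(\bar x,\bar y)\in\Omega_n}w_n(\bar x,x_0)\,D[\bar x,\bar y]}.$$ Bootstrap distance. $B(D,D')=\sum_{(\bar x,\bar y)\in\Omega_n}D[\bar x,\bar y]\log\left(D[\bar x,\bar y]/D'[\bar x,\bar y]\right)$ (relative entropy, $0\log0=0$, value $+\infty$ if $D\not\ll D'$). Convention: at $\nu=0$ the expression $\nu\log(\sum_i\exp(a_i/\nu)D_i)$ is understood as its limit for $\nu\downarrow0$, i.e. $\max\{a_i:D_i>0\}$. *)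

theory Defs
  imports "HOL-Probability.Probability"
begin

definition distributions_on :: "'a set \<Rightarrow> 'a pmf set" where
  "distributions_on S = {D. set_pmf D \<subseteq> S}"

text \<open>Convexity of an extended-valued function that does not take the value \<open>-\<infinity>\<close>. Since
  \<open>0 * \<infinity> = 0\<close> in \<^typ>\<open>ereal\<close>, the boundary cases \<open>u = 0\<close> and \<open>u = 1\<close> are harmless.\<close>

definition convex_extended :: "('z::real_vector \<Rightarrow> ereal) \<Rightarrow> bool" where
  "convex_extended f \<longleftrightarrow>
     (\<forall>z z' u. 0 \<le> u \<longrightarrow> u \<le> 1 \<longrightarrow>
        f (u *\<^sub>R z + (1 - u) *\<^sub>R z') \<le> ereal u * f z + ereal (1 - u) * f z')"

definition nadaraya_watson ::
  "('x \<times> 'y) set \<Rightarrow> ('x \<Rightarrow> 'x \<Rightarrow> real) \<Rightarrow> ('z \<Rightarrow> 'y \<Rightarrow> ereal)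
     \<Rightarrow> 'z \<Rightarrow> ('x \<times> 'y) pmf \<Rightarrow> 'x \<Rightarrow> ereal" where
  "nadaraya_watson S w L z D x0 =
     (\<Sum>(x, y)\<in>S. L z y * ereal (w x x0) * ereal (pmf D (x, y)))
       / ereal (\<Sum>(x, y)\<in>S. w x x0 * pmf D (x, y))"

text \<open>Relative entropy on a finite set \<open>S\<close>. As HOL functions are total, the case that \<open>D\<close> is not
  absolutely continuous with respect to \<open>D'\<close> has to be separated explicitly.\<close>

definition bootstrap_distance :: "'a set \<Rightarrow> 'a pmf \<Rightarrow> 'a pmf \<Rightarrow> ereal" where
  "bootstrap_distance S D D' =
     (if \<forall>p\<in>S. pmf D' p = 0 \<longrightarrow> pmf D p = 0
      then ereal (\<Sum>p\<in>S. pmf D p * ln (pmf D p / pmf D' p))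
      else \<infinity>)"

definition robust_nw_cost ::
  "('x \<times> 'y) set \<Rightarrow> ('x \<Rightarrow> 'x \<Rightarrow> real) \<Rightarrow> ('z \<Rightarrow> 'y \<Rightarrow> ereal) \<Rightarrow> real
     \<Rightarrow> 'z \<Rightarrow> ('x \<times> 'y) pmf \<Rightarrow> 'x \<Rightarrow> ereal" where
  "robust_nw_cost S w L r z D x0 =
     (SUP D' \<in> {D' \<in> distributions_on S. bootstrap_distance S D' D \<le> ereal r}.
        nadaraya_watson S w L z D' x0)"

text \<open>The function \<open>\<nu> log (\<Sum> exp (a / \<nu>) D)\<close>, extended to \<open>\<nu> = 0\<close> by its limit for
  \<open>\<nu>\<down>0\<close>; the lemma below confirms that this limit is the stated maximum.\<close>

definition log_sum_exp :: "'a set \<Rightarrow> ('a \<Rightarrow> real) \<Rightarrow> 'a pmf \<Rightarrow> real \<Rightarrow> real" where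
  "log_sum_exp S a D \<nu> =
     (if \<nu> = 0 then Max (a ` {p \<in> S. pmf D p > 0})
      else \<nu> * ln (\<Sum>p\<in>S. exp (a p / \<nu>) * pmf D p))"

lemma log_sum_exp_tendsto:
  assumes fin: "finite S" and D: "D \<in> distributions_on S"
  shows "(log_sum_exp S a D \<longlongrightarrow> log_sum_exp S a D 0) (at_right 0)"
proof -
  let ?P = "{p \<in> S. pmf D p > 0}"
  define m where "m = Max (a ` ?P)"
  have sub: "set_pmf D \<subseteq> S" using D by (simp add: distributions_on_def)
  have sum1: "(\<Sum>p\<in>S. pmf D p) = 1" by (rule sum_pmf_eq_1[OF fin sub])
  obtain q0 where "q0 \<in> set_pmf D" using set_pmf_not_empty[of D] by blast
  with sub have ne: "?P \<noteq> {}" by (auto simp: pmf_positive)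
  have finP: "finite ?P" using fin by simp
  have "m \<in> a ` ?P" unfolding m_def using finP ne by (intro Max_in) auto
  then obtain q where q: "q \<in> S" "pmf D q > 0" "a q = m" by auto
  have le: "a p \<le> m" if "p \<in> S" "pmf D p > 0" for p
    unfolding m_def using finP that by (intro Max_ge) auto
  have bounds: "m + \<nu> * ln (pmf D q) \<le> log_sum_exp S a D \<nu> \<and> log_sum_exp S a D \<nu> \<le> m"
    if \<nu>: "\<nu> > 0" for \<nu>
  proof -
    let ?s = "\<Sum>p\<in>S. exp (a p / \<nu>) * pmf D p"
    have lo: "exp (m / \<nu>) * pmf D q \<le> ?s"
      using member_le_sum[of q S "\<lambda>p. exp (a p / \<nu>) * pmf D p"] q fin by auto
    have "?s \<le> (\<Sum>p\<in>S. exp (m / \<nu>) * pmf D p)"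
    proof (rule sum_mono)
      fix p assume "p \<in> S"
      show "exp (a p / \<nu>) * pmf D p \<le> exp (m / \<nu>) * pmf D p"
      proof (cases "pmf D p > 0")
        case True
        with le[OF \<open>p \<in> S\<close>] \<nu> show ?thesis by (simp add: divide_right_mono)
      next
        case False
        then have "pmf D p = 0" using pmf_nonneg[of D p] by linarith
        then show ?thesis by simp
      qed
    qed
    then have hi: "?s \<le> exp (m / \<nu>)" by (simp add: sum_distrib_left[symmetric] sum1)
    have pos: "0 < exp (m / \<nu>) * pmf D q" using q by simp
    have "ln (exp (m / \<nu>) * pmf D q) \<le> ln ?s" using lo pos by (subst ln_le_cancel_iff) linarith+
    then have "m / \<nu> + ln (pmf D q) \<le> ln ?s" using q by (simp add: ln_mult)
    then have 1: "\<nu> * (m / \<nu> + ln (pmf D q)) \<le> \<nu> * ln ?s" using \<nu> by (intro mult_left_mono) auto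
    have "ln ?s \<le> ln (exp (m / \<nu>))" using lo pos hi by (subst ln_le_cancel_iff) linarith+
    then have 2: "\<nu> * ln ?s \<le> \<nu> * (m / \<nu>)" using \<nu> by (intro mult_left_mono) auto
    show ?thesis using 1 2 \<nu> by (simp add: log_sum_exp_def distrib_left)
  qed
  have ev: "eventually (\<lambda>\<nu>::real. \<nu> > 0) (at_right 0)" by (simp add: eventually_at_right_less)
  have "((\<lambda>\<nu>. m + \<nu> * ln (pmf D q)) \<longlongrightarrow> m + 0 * ln (pmf D q)) (at_right 0)"
    by (intro tendsto_intros)
  then have "((\<lambda>\<nu>. m + \<nu> * ln (pmf D q)) \<longlongrightarrow> m) (at_right 0)" by simp
  then have "(log_sum_exp S a D \<longlongrightarrow> m) (at_right 0)"
    by (rule tendsto_sandwich[rotated 2, OF _ tendsto_const])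
       (use ev in \<open>eventually_elim, use bounds in blast\<close>)+
  then show ?thesis by (simp add: log_sum_exp_def m_def)
qed

text \<open>The dual is only meaningful when the loss is finite on the data, where
  \<^const>\<open>real_of_ereal\<close> is the loss itself.\<close>

definition dual_constraint ::
  "('x \<times> 'y) set \<Rightarrow> ('x \<Rightarrow> 'x \<Rightarrow> real) \<Rightarrow> ('z \<Rightarrow> 'y \<Rightarrow> ereal) \<Rightarrow> real
     \<Rightarrow> 'z \<Rightarrow> ('x \<times> 'y) pmf \<Rightarrow> 'x \<Rightarrow> real \<times> real \<Rightarrow> real" where
  "dual_constraint S w L r z D x0 = (\<lambda>(\<alpha>, \<nu>).
     log_sum_exp S (\<lambda>(x, y). (real_of_ereal (L z y) - \<alpha>) * w x x0) D \<nu> + r * \<nu>)"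

definition dual_value ::
  "('x \<times> 'y) set \<Rightarrow> ('x \<Rightarrow> 'x \<Rightarrow> real) \<Rightarrow> ('z \<Rightarrow> 'y \<Rightarrow> ereal) \<Rightarrow> real
     \<Rightarrow> 'z \<Rightarrow> ('x \<times> 'y) pmf \<Rightarrow> 'x \<Rightarrow> ereal" where
  "dual_value S w L r z D x0 =
     (INF (\<alpha>, \<nu>) \<in> {(\<alpha>, \<nu>). 0 \<le> \<nu> \<and> dual_constraint S w L r z D x0 (\<alpha>, \<nu>) \<le> 0}. ereal \<alpha>)"

end

theory Submission
  imports Defs
begin

text \<open>
  Write \<open>a\<^sub>\<alpha>(x, y) = (L(z, y) - \<alpha>) w(x, x\<^sub>0)\<close>. As the weights are positive, the Nadaraya-Watson
  estimate under \<open>D'\<close> is at most \<open>\<alpha>\<close> if and only if the \<open>D'\<close>-mean of \<open>a\<^sub>\<alpha>\<close> is at most \<open>0\<close>. Clearing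
  the denominator in this way turns the fractional problem into a linear one over an entropy ball,
  for every fixed \<open>\<alpha>\<close>.

  The linear problem is governed by the Gibbs variational principle: for \<open>\<nu> \<ge> 0\<close>, the number
  \<open>\<nu> log E\<^sub>D[exp (a / \<nu>)]\<close> is the maximum of \<open>E\<^sub>q[a] - \<nu> B(q, D)\<close> over all \<open>q \<lless> D\<close>.

  \<^item> The inequality \<open>mean_le_log_sum_exp\<close> is weak duality: a feasible \<open>(\<alpha>, \<nu>)\<close> makes the mean of
    \<open>a\<^sub>\<alpha>\<close> nonpositive on the whole ball.

  \<^item> Attainment, \<open>log_sum_exp_attained\<close>, exhibits the dual constraint as a maximum of functions that
    are affine in \<open>(\<alpha>, \<nu>)\<close>; this gives joint convexity, including the boundary \<open>\<nu> = 0\<close>.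

  \<^item> For strong duality, \<open>entropy_ball_multiplier\<close>, let the mean of \<open>a\<close> be negative on the whole
    ball, and move along the exponentially tilted distributions \<open>q\<^sub>t \<propto> exp (t a) D\<close>. Their entropy
    \<open>B(q\<^sub>t, D)\<close> is continuous in \<open>t\<close> and vanishes at \<open>t = 0\<close>. If it reaches the radius \<open>r > 0\<close> at
    some \<open>t\<close>, then the constraint at \<open>\<nu> = 1 / t\<close> equals the mean of \<open>a\<close> under \<open>q\<^sub>t\<close>, hence is
    negative. Otherwise the whole curve stays in the ball, so that \<open>log E\<^sub>D[exp (t a)]\<close>, whose
    derivative is the mean of \<open>a\<close> under \<open>q\<^sub>t\<close>, never exceeds its initial value \<open>0\<close>; letting
    \<open>t \<rightarrow> \<infinity>\<close> shows that \<open>\<nu> = 0\<close> is feasible. If \<open>r = 0\<close>, then the same derivative at \<open>t = 0\<close> makes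
    every sufficiently large \<open>\<nu>\<close> feasible.
\<close>

section \<open>Exponential tilting\<close>

definition mean_on :: "'a set \<Rightarrow> ('a \<Rightarrow> real) \<Rightarrow> 'a pmf \<Rightarrow> real" where
  "mean_on S a q = (\<Sum>p\<in>S. a p * pmf q p)"

definition moment_gen :: "'a set \<Rightarrow> ('a \<Rightarrow> real) \<Rightarrow> 'a pmf \<Rightarrow> real \<Rightarrow> real" where
  "moment_gen S a D t = (\<Sum>p\<in>S. exp (t * a p) * pmf D p)"

definition tilt :: "'a set \<Rightarrow> ('a \<Rightarrow> real) \<Rightarrow> 'a pmf \<Rightarrow> real \<Rightarrow> 'a pmf" where
  "tilt S a D t = embed_pmf (\<lambda>p. exp (t * a p) * pmf D p / moment_gen S a D t)"

lemma pmf_outside: "D \<in> distributions_on S \<Longrightarrow> p \<notin> S \<Longrightarrow> pmf D p = 0"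
  by (auto simp: distributions_on_def set_pmf_iff)

lemma sum_pmf_distributions_on:
  "finite S \<Longrightarrow> D \<in> distributions_on S \<Longrightarrow> (\<Sum>p\<in>S. pmf D p) = 1"
  by (simp add: distributions_on_def sum_pmf_eq_1)

lemma exists_pos_pmf:
  assumes "D \<in> distributions_on S"
  obtains p where "p \<in> S" "pmf D p > 0"
proof -
  obtain p where "p \<in> set_pmf D" using set_pmf_not_empty[of D] by blast
  with assms show thesis by (intro that[of p]) (auto simp: distributions_on_def pmf_positive)
qed

lemma moment_gen_pos:
  assumes "finite S" "D \<in> distributions_on S"
  shows "moment_gen S a D t > 0"
proof -
  obtain p where "p \<in> S" "pmf D p > 0" using exists_pos_pmf[OF assms(2)] .
  then show ?thesis unfolding moment_gen_def
    using assms(1) by (intro sum_pos2[of S p]) auto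
qed

lemma moment_gen_0: "finite S \<Longrightarrow> D \<in> distributions_on S \<Longrightarrow> moment_gen S a D 0 = 1"
  by (simp add: moment_gen_def sum_pmf_distributions_on)

lemma pmf_tilt:
  assumes "finite S" "D \<in> distributions_on S"
  shows "pmf (tilt S a D t) p = exp (t * a p) * pmf D p / moment_gen S a D t"
  unfolding tilt_def
proof (rule pmf_embed_pmf)
  let ?f = "\<lambda>p. exp (t * a p) * pmf D p / moment_gen S a D t"
  note pos = moment_gen_pos[OF assms, of a t]
  show nn: "0 \<le> ?f p" for p using pos by simp
  have "(\<integral>\<^sup>+p. ennreal (?f p) \<partial>count_space UNIV) = (\<Sum>p\<in>S. ennreal (?f p))"
    by (rule nn_integral_count_space'[OF assms(1)]) (use pmf_outside[OF assms(2)] in auto)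
  also have "\<dots> = ennreal (\<Sum>p\<in>S. ?f p)" by (rule sum_ennreal) (use nn in auto)
  also have "(\<Sum>p\<in>S. ?f p) = 1"
    using pos by (simp add: sum_divide_distrib[symmetric] moment_gen_def)
  finally show "(\<integral>\<^sup>+p. ennreal (?f p) \<partial>count_space UNIV) = 1" by simp
qed

lemma tilt_distributions_on:
  assumes "finite S" "D \<in> distributions_on S"
  shows "tilt S a D t \<in> distributions_on S"
proof -
  have "p \<in> S" if "pmf (tilt S a D t) p \<noteq> 0" for p
    using that pmf_outside[OF assms(2), of p] by (cases "p \<in> S") (simp_all add: pmf_tilt[OF assms])
  then show ?thesis by (auto simp: distributions_on_def set_pmf_iff simp del: pmf_eq_0_set_pmf)
qed

lemma tilt_0: "finite S \<Longrightarrow> D \<in> distributions_on S \<Longrightarrow> tilt S a D 0 = D"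
  by (rule pmf_eqI) (simp add: pmf_tilt moment_gen_0)

lemma mean_on_tilt:
  assumes "finite S" "D \<in> distributions_on S"
  shows "mean_on S a (tilt S a D t)
    = (\<Sum>p\<in>S. a p * exp (t * a p) * pmf D p) / moment_gen S a D t"
  by (simp add: mean_on_def pmf_tilt[OF assms] sum_divide_distrib mult.assoc)

text \<open>The log-density of the tilted distribution is \<open>t a(p) - log E\<^sub>D[exp (t a)]\<close>, whose mean under
  that distribution is immediate.\<close>

lemma bootstrap_distance_tilt:
  assumes fin: "finite S" and D: "D \<in> distributions_on S"
  shows "bootstrap_distance S (tilt S a D t) D
    = ereal (t * mean_on S a (tilt S a D t) - ln (moment_gen S a D t))"
proof -
  let ?q = "tilt S a D t" and ?Z = "moment_gen S a D t"
  note pos = moment_gen_pos[OF fin D, of a t]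
  have "pmf ?q p * ln (pmf ?q p / pmf D p) = t * (a p * pmf ?q p) - ln ?Z * pmf ?q p" for p
  proof (cases "pmf D p = 0")
    case False
    then have log_density: "ln (pmf ?q p / pmf D p) = t * a p - ln ?Z"
      using pos by (simp add: pmf_tilt[OF fin D] ln_div)
    show ?thesis unfolding log_density by (simp add: algebra_simps)
  qed (simp add: pmf_tilt[OF fin D])
  then have "(\<Sum>p\<in>S. pmf ?q p * ln (pmf ?q p / pmf D p))
      = (\<Sum>p\<in>S. t * (a p * pmf ?q p) - ln ?Z * pmf ?q p)" by simp
  also have "\<dots> = t * mean_on S a ?q - ln ?Z * (\<Sum>p\<in>S. pmf ?q p)"
    by (simp add: sum_subtractf sum_distrib_left mean_on_def)
  also have "(\<Sum>p\<in>S. pmf ?q p) = 1"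
    by (rule sum_pmf_distributions_on[OF fin tilt_distributions_on[OF fin D]])
  finally show ?thesis by (simp add: bootstrap_distance_def pmf_tilt[OF fin D])
qed

lemma log_sum_exp_eq_moment_gen:
  "t > 0 \<Longrightarrow> log_sum_exp S a D (1 / t) = ln (moment_gen S a D t) / t"
  by (simp add: log_sum_exp_def moment_gen_def mult.commute)

lemma ln_moment_gen_has_derivative:
  assumes "finite S" "D \<in> distributions_on S"
  shows "((\<lambda>t. ln (moment_gen S a D t)) has_real_derivative mean_on S a (tilt S a D t)) (at t)"
proof -
  have "(moment_gen S a D has_real_derivative (\<Sum>p\<in>S. a p * exp (t * a p) * pmf D p)) (at t)"
    unfolding moment_gen_def
    by (auto intro!: derivative_eq_intros sum.cong simp: mult_ac)
  from DERIV_ln_divide[THEN DERIV_chain2, OF moment_gen_pos[OF assms] this]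
  show ?thesis by (simp add: mean_on_tilt[OF assms])
qed

section \<open>The Gibbs variational principle\<close>

text \<open>For \<open>\<nu> > 0\<close> this is nonnegativity of the relative entropy of \<open>q\<close> with respect to the tilted
  distribution, which follows pointwise from \<open>ln u \<le> u - 1\<close>; for \<open>\<nu> = 0\<close> it says that a mean
  is at most the maximum over the support.\<close>

lemma mean_le_log_sum_exp:
  assumes fin: "finite S" and D: "D \<in> distributions_on S" and q: "q \<in> distributions_on S"
    and k: "bootstrap_distance S q D \<le> ereal k" and nu: "\<nu> \<ge> 0"
  shows "mean_on S a q \<le> log_sum_exp S a D \<nu> + k * \<nu>"
proof -
  have ac: "\<forall>p\<in>S. pmf D p = 0 \<longrightarrow> pmf q p = 0"
    using k by (auto simp: bootstrap_distance_def split: if_splits)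
  then have ent: "(\<Sum>p\<in>S. pmf q p * ln (pmf q p / pmf D p)) \<le> k"
    using k by (simp add: bootstrap_distance_def)
  have q1: "(\<Sum>p\<in>S. pmf q p) = 1" by (rule sum_pmf_distributions_on[OF fin q])
  show ?thesis
  proof (cases "\<nu> = 0")
    case True
    let ?m = "Max (a ` {p \<in> S. pmf D p > 0})"
    have "a p * pmf q p \<le> ?m * pmf q p" if "p \<in> S" for p
    proof (cases "pmf q p = 0")
      case False
      then have "pmf D p > 0" using ac that by (auto simp: less_le)
      then have "a p \<le> ?m" using fin that by (intro Max_ge) auto
      then show ?thesis by (intro mult_right_mono) auto
    qed simp
    then have "mean_on S a q \<le> (\<Sum>p\<in>S. ?m * pmf q p)"
      unfolding mean_on_def by (rule sum_mono)
    also have "\<dots> = ?m" by (simp add: sum_distrib_left[symmetric] q1)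
    finally show ?thesis using True by (simp add: log_sum_exp_def)
  next
    case False
    define t where "t = 1 / \<nu>"
    have t: "t > 0" "\<nu> = 1 / t" using nu False by (auto simp: t_def)
    define Z where "Z = moment_gen S a D t"
    have Z: "Z > 0" unfolding Z_def by (rule moment_gen_pos[OF fin D])
    have "t * (a p * pmf q p) - ln Z * pmf q p - pmf q p * ln (pmf q p / pmf D p)
        \<le> exp (t * a p) * pmf D p / Z - pmf q p" if "p \<in> S" for p
    proof (cases "pmf q p = 0")
      case True
      then show ?thesis using Z by simp
    next
      case False
      then have pos: "pmf q p > 0" "pmf D p > 0" using ac that by (auto simp: less_le)
      define u where "u = exp (t * a p) * pmf D p / (Z * pmf q p)"
      have u: "u > 0" using pos Z by (simp add: u_def)
      have ln_u: "ln u = t * a p - ln Z - ln (pmf q p / pmf D p)"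
        using pos Z by (simp add: u_def ln_div ln_mult)
      have "t * (a p * pmf q p) - ln Z * pmf q p - pmf q p * ln (pmf q p / pmf D p)
          = pmf q p * ln u" unfolding ln_u by (simp add: algebra_simps)
      also have "\<dots> \<le> pmf q p * (u - 1)"
        using ln_le_minus_one[OF u] by (intro mult_left_mono) auto
      also have "\<dots> = exp (t * a p) * pmf D p / Z - pmf q p"
        using pos Z by (simp add: u_def field_simps)
      finally show ?thesis .
    qed
    then have "(\<Sum>p\<in>S. t * (a p * pmf q p) - ln Z * pmf q p - pmf q p * ln (pmf q p / pmf D p))
        \<le> (\<Sum>p\<in>S. exp (t * a p) * pmf D p / Z - pmf q p)" by (rule sum_mono)
    also have "\<dots> = 0"
      using Z q1 by (simp add: sum_subtractf sum_divide_distrib[symmetric] Z_def moment_gen_def)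
    finally have "t * mean_on S a q - ln Z - (\<Sum>p\<in>S. pmf q p * ln (pmf q p / pmf D p)) \<le> 0"
      by (simp add: sum_subtractf sum_distrib_left[symmetric] mean_on_def q1)
    with ent have "t * mean_on S a q \<le> ln Z + k" by simp
    then show ?thesis
      using t(1) unfolding t(2) log_sum_exp_eq_moment_gen[OF t(1)] Z_def
      by (simp add: field_simps)
  qed
qed

text \<open>The maximiser is the tilted distribution at \<open>t = 1 / \<nu>\<close>, and a point mass at a maximum of
  \<open>a\<close> over the support of \<open>D\<close> if \<open>\<nu> = 0\<close>.\<close>

lemma log_sum_exp_attained:
  assumes fin: "finite S" and D: "D \<in> distributions_on S" and nu: "\<nu> \<ge> 0"
  obtains q k where "q \<in> distributions_on S" "bootstrap_distance S q D = ereal k"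
    "mean_on S a q = log_sum_exp S a D \<nu> + k * \<nu>"
proof (cases "\<nu> = 0")
  case True
  let ?P = "{p \<in> S. pmf D p > 0}"
  have "?P \<noteq> {}" using exists_pos_pmf[OF D] by blast
  then have "Max (a ` ?P) \<in> a ` ?P" using fin by (intro Max_in) auto
  then obtain p where p: "p \<in> S" "pmf D p > 0" "Max (a ` ?P) = a p" by auto
  have "mean_on S a (return_pmf p) = (\<Sum>p'\<in>S. if p' = p then a p else 0)"
    unfolding mean_on_def by (rule sum.cong) (auto simp: indicator_def)
  then have mean: "mean_on S a (return_pmf p) = a p"
    using fin p by simp
  have "\<exists>k. bootstrap_distance S (return_pmf p) D = ereal k"
    using p(2) by (auto simp: bootstrap_distance_def indicator_def)
  then obtain k where "bootstrap_distance S (return_pmf p) D = ereal k" ..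
  then show ?thesis
    using p(1,3) mean True
    by (intro that[of "return_pmf p" k]) (auto simp: distributions_on_def log_sum_exp_def)
next
  case False
  define t where "t = 1 / \<nu>"
  have t: "t > 0" "\<nu> = 1 / t" using nu False by (auto simp: t_def)
  show ?thesis
    by (rule that[OF tilt_distributions_on[OF fin D] bootstrap_distance_tilt[OF fin D, of a t]])
       (use t(1) in \<open>simp add: t(2) log_sum_exp_eq_moment_gen field_simps\<close>)
qed

section \<open>Multipliers for the entropy ball\<close>

text \<open>Lagrange duality without a separation argument. For \<open>r > 0\<close>, \<open>1 / \<nu>\<close> is a time at which the
  curve of tilted distributions meets the boundary of the ball, and \<open>\<nu> = 0\<close> if it never does. For
  \<open>r = 0\<close> the ball is the single point \<open>D\<close>, which the curve leaves at once, and the multiplier is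
  found from the first-order behaviour at \<open>t = 0\<close> instead.\<close>

lemma entropy_ball_multiplier:
  assumes fin: "finite S" and D: "D \<in> distributions_on S" and r: "r \<ge> 0"
    and neg: "\<And>q. q \<in> distributions_on S \<Longrightarrow> bootstrap_distance S q D \<le> ereal r \<Longrightarrow> mean_on S a q < 0"
  obtains \<nu> where "\<nu> \<ge> 0" "log_sum_exp S a D \<nu> + r * \<nu> \<le> 0"
proof -
  define q where "q t = tilt S a D t" for t
  define K where "K t = ln (moment_gen S a D t)" for t
  define h where "h t = t * mean_on S a (q t) - K t" for t
  \<comment> \<open>\<open>h\<close> is the entropy along the curve, the Legendre gap \<open>t K'(t) - K(t)\<close>.\<close>
  have dist: "bootstrap_distance S (q t) D = ereal (h t)" for t
    unfolding q_def K_def h_def by (rule bootstrap_distance_tilt[OF fin D])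
  have qS: "q t \<in> distributions_on S" for t
    unfolding q_def by (rule tilt_distributions_on[OF fin D])
  have mneg: "mean_on S a (q t) < 0" if "h t \<le> r" for t
    using neg[OF qS[of t]] dist that by simp
  have K': "(K has_real_derivative mean_on S a (q t)) (at t)" for t
    unfolding K_def q_def by (rule ln_moment_gen_has_derivative[OF fin D])
  have K0: "K 0 = 0" by (simp add: K_def moment_gen_0[OF fin D])
  have h0: "h 0 = 0" by (simp add: h_def K0)
  have lse: "log_sum_exp S a D (1 / t) = K t / t" if "t > 0" for t
    unfolding K_def by (rule log_sum_exp_eq_moment_gen[OF that])
  consider "r = 0" | t where "r > 0" "t > 0" "h t = r" | "r > 0" "\<And>t. t > 0 \<Longrightarrow> h t \<noteq> r"
    using r by fastforce
  then show ?thesis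
  proof cases
    case 1
    have "mean_on S a (q 0) < 0" by (rule mneg) (simp add: h0 1)
    from DERIV_neg_dec_right[OF K' this]
    obtain d where d: "d > 0" "\<forall>e>0. e < d \<longrightarrow> K (0 + e) < K 0" by blast
    then have "K (d / 2) < 0" using K0 by (auto dest: spec[of _ "d / 2"])
    then have "log_sum_exp S a D (1 / (d / 2)) \<le> 0"
      using d(1) by (subst lse) (simp_all add: mult_nonneg_nonpos divide_nonpos_pos)
    with 1 d(1) show ?thesis by (intro that[of "1 / (d / 2)"]) simp_all
  next
    case 2
    then have "log_sum_exp S a D (1 / t) + r * (1 / t) = mean_on S a (q t)"
      using lse[of t] by (simp add: h_def field_simps)
    with mneg[of t] 2 show ?thesis by (intro that[of "1 / t"]) auto
  next
    case 3
    have cont: "continuous_on A h" for A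
    proof -
      have "continuous_on A K"
        using K' by (meson DERIV_isCont continuous_at_imp_continuous_on)
      moreover have "continuous_on A (\<lambda>t. mean_on S a (q t))"
        unfolding q_def mean_on_tilt[OF fin D] moment_gen_def
        by (intro continuous_intros)
           (use moment_gen_pos[OF fin D, of a] in \<open>simp add: moment_gen_def less_imp_neq[symmetric]\<close>)
      ultimately show ?thesis unfolding h_def by (intro continuous_intros)
    qed
    have inball: "h t < r" if "t \<ge> 0" for t
    proof (rule ccontr)
      assume "\<not> h t < r"
      then have "h 0 \<le> r" "r \<le> h t" using h0 3(1) by linarith+
      then obtain s where "0 \<le> s" "s \<le> t" "h s = r"
        using IVT'[OF _ _ \<open>t \<ge> 0\<close> cont] by blast
      then show False using 3 h0 by (cases "s = 0") auto
    qed
    have "K t \<le> K 0" if "t > 0" for t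
      by (rule DERIV_nonpos_imp_nonincreasing)
         (use that K' mneg inball in \<open>auto intro!: exI less_imp_le\<close>)
    then have "log_sum_exp S a D \<nu> \<le> 0" if "\<nu> > 0" for \<nu>
      using lse[of "1 / \<nu>"] that K0 by (simp add: mult_nonpos_nonneg)
    then have "eventually (\<lambda>\<nu>. log_sum_exp S a D \<nu> \<le> 0) (at_right 0)"
      using eventually_at_right_less[of "0::real"] by (auto elim: eventually_mono)
    then have "log_sum_exp S a D 0 \<le> 0"
      by (intro tendsto_upperbound[OF log_sum_exp_tendsto[OF fin D]]) auto
    then show ?thesis by (intro that[of 0]) auto
  qed
qed

section \<open>The Nadaraya-Watson estimator\<close>

text \<open>The integrand \<open>a\<^sub>\<alpha>\<close> that is left after clearing the denominator.\<close>

definition excess :: "('x \<Rightarrow> 'x \<Rightarrow> real) \<Rightarrow> ('z \<Rightarrow> 'y \<Rightarrow> ereal) \<Rightarrow> 'z \<Rightarrow> 'x \<Rightarrow> real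
    \<Rightarrow> 'x \<times> 'y \<Rightarrow> real" where
  "excess w L z x0 \<alpha> = (\<lambda>(x, y). (real_of_ereal (L z y) - \<alpha>) * w x x0)"

lemma dual_constraint_excess:
  "dual_constraint S w L r z D x0 (\<alpha>, \<nu>) = log_sum_exp S (excess w L z x0 \<alpha>) D \<nu> + r * \<nu>"
  by (simp add: dual_constraint_def excess_def)

lemma mean_on_excess:
  "mean_on S (excess w L z x0 \<alpha>) q
    = mean_on S (excess w L z x0 0) q - \<alpha> * (\<Sum>(x, y)\<in>S. w x x0 * pmf q (x, y))"
proof -
  have "excess w L z x0 \<alpha> p * pmf q p
      = excess w L z x0 0 p * pmf q p - \<alpha> * (case p of (x, y) \<Rightarrow> w x x0 * pmf q (x, y))" for p
    by (cases p) (simp add: excess_def algebra_simps)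
  then show ?thesis by (simp add: mean_on_def sum_subtractf sum_distrib_left)
qed

lemma weight_sum_pos:
  assumes "finite S" "q \<in> distributions_on S" "\<And>x. w x x0 > 0"
  shows "(\<Sum>(x, y)\<in>S. w x x0 * pmf q (x, y)) > (0::real)"
proof -
  obtain p where "p \<in> S" "pmf q p > 0" using exists_pos_pmf[OF assms(2)] .
  then show ?thesis
    using assms(1,3) by (intro sum_pos2[of S p]) (auto split: prod.splits simp: less_imp_le)
qed

text \<open>Both sides are multiplied by the total weight, which is positive.\<close>

lemma nadaraya_watson_le_iff:
  fixes w :: "'x \<Rightarrow> 'x \<Rightarrow> real" and L :: "'z \<Rightarrow> 'y \<Rightarrow> ereal"
  assumes fin: "finite S" and q: "q \<in> distributions_on S" and w: "\<And>x. w x x0 > 0"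
    and L: "\<And>x y. (x, y) \<in> S \<Longrightarrow> \<bar>L z y\<bar> \<noteq> \<infinity>"
  shows "nadaraya_watson S w L z q x0 \<le> ereal \<alpha> \<longleftrightarrow> mean_on S (excess w L z x0 \<alpha>) q \<le> 0"
    and "nadaraya_watson S w L z q x0 < ereal \<alpha> \<longleftrightarrow> mean_on S (excess w L z x0 \<alpha>) q < 0"
proof -
  let ?W = "\<Sum>(x, y)\<in>S. w x x0 * pmf q (x, y)"
  have W: "?W > 0" using weight_sum_pos[of S q w x0] fin q w by blast
  have "(\<Sum>(x, y)\<in>S. L z y * ereal (w x x0) * ereal (pmf q (x, y)))
      = (\<Sum>p\<in>S. ereal (excess w L z x0 0 p * pmf q p))"
  proof (rule sum.cong[OF refl])
    fix p assume "p \<in> S"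
    obtain x y where p: "p = (x, y)" by (cases p)
    obtain l where "L z y = ereal l" using L[of x y] \<open>p \<in> S\<close> p by (cases "L z y") auto
    then show "(case p of (x, y) \<Rightarrow> L z y * ereal (w x x0) * ereal (pmf q (x, y)))
        = ereal (excess w L z x0 0 p * pmf q p)"
      by (simp add: p excess_def)
  qed
  then have "nadaraya_watson S w L z q x0 = ereal (mean_on S (excess w L z x0 0) q / ?W)"
    using W by (simp add: nadaraya_watson_def mean_on_def)
  then show "nadaraya_watson S w L z q x0 \<le> ereal \<alpha> \<longleftrightarrow> mean_on S (excess w L z x0 \<alpha>) q \<le> 0"
    "nadaraya_watson S w L z q x0 < ereal \<alpha> \<longleftrightarrow> mean_on S (excess w L z x0 \<alpha>) q < 0"
    using W unfolding mean_on_excess[of S w L z x0 \<alpha>]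
    by (simp_all add: pos_divide_le_eq pos_divide_less_eq)
qed

theorem robust_nw_cost_eq_dual_value:
  fixes w :: "'x \<Rightarrow> 'x \<Rightarrow> real" and L :: "'z \<Rightarrow> 'y \<Rightarrow> ereal"
  assumes fin: "finite S" and D: "D \<in> distributions_on S" and w: "\<And>x. w x x0 > 0"
    and L: "\<And>x y. (x, y) \<in> S \<Longrightarrow> \<bar>L z y\<bar> \<noteq> \<infinity>" and r: "r \<ge> 0"
  shows "robust_nw_cost S w L r z D x0 = dual_value S w L r z D x0"
proof (rule antisym)
  note nw_iff = nadaraya_watson_le_iff[where w = w and L = L and z = z and ?x0.0 = x0,
      OF fin _ w L]
  show "robust_nw_cost S w L r z D x0 \<le> dual_value S w L r z D x0"
    unfolding robust_nw_cost_def dual_value_def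
  proof (intro SUP_least INF_greatest, clarify)
    fix q \<alpha> \<nu>
    assume q: "q \<in> distributions_on S" "bootstrap_distance S q D \<le> ereal r"
      and nu: "(0::real) \<le> \<nu>" "dual_constraint S w L r z D x0 (\<alpha>, \<nu>) \<le> 0"
    have "mean_on S (excess w L z x0 \<alpha>) q \<le> 0"
      using mean_le_log_sum_exp[OF fin D q nu(1), of "excess w L z x0 \<alpha>"] nu(2)
      by (simp add: dual_constraint_excess)
    then show "nadaraya_watson S w L z q x0 \<le> ereal \<alpha>"
      by (simp add: nw_iff(1)[OF q(1)])
  qed
  show "dual_value S w L r z D x0 \<le> robust_nw_cost S w L r z D x0"
    \<comment> \<open>Passing to a strictly larger \<open>\<alpha>\<close> makes the mean strictly negative, as the multiplier needs.\<close>
  proof (rule dense_ge)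
    fix b assume b: "robust_nw_cost S w L r z D x0 < b"
    show "dual_value S w L r z D x0 \<le> b"
    proof (cases b)
      case (real \<alpha>)
      have "mean_on S (excess w L z x0 \<alpha>) q < 0"
        if q: "q \<in> distributions_on S" "bootstrap_distance S q D \<le> ereal r" for q
      proof -
        have "nadaraya_watson S w L z q x0 \<le> robust_nw_cost S w L r z D x0"
          unfolding robust_nw_cost_def using q by (intro SUP_upper) auto
        with b real have "nadaraya_watson S w L z q x0 < ereal \<alpha>" by simp
        then show ?thesis by (simp add: nw_iff(2)[OF q(1)])
      qed
      then obtain \<nu> where "\<nu> \<ge> 0" "log_sum_exp S (excess w L z x0 \<alpha>) D \<nu> + r * \<nu> \<le> 0"
        using entropy_ball_multiplier[OF fin D r, of "excess w L z x0 \<alpha>"] by blast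
      then show ?thesis
        unfolding real dual_value_def
        by (intro INF_lower2[of "(\<alpha>, \<nu>)"]) (auto simp: dual_constraint_excess)
    qed (use b in auto)
  qed
qed

text \<open>By the variational principle, the constraint is at every point \<open>(\<alpha>, \<nu>)\<close> equal to one of the
  functions \<open>E\<^sub>q[a\<^sub>\<alpha>] + (r - B(q, D)) \<nu>\<close>, each of which is affine and lies below the constraint
  everywhere.\<close>

theorem convex_on_dual_constraint:
  assumes fin: "finite S" and D: "D \<in> distributions_on S"
  shows "convex_on (UNIV \<times> {0..}) (dual_constraint S w L r z D x0)"
proof (rule convex_onI)
  show "convex (UNIV \<times> {0::real..} :: (real \<times> real) set)"
    by (intro convex_Times) auto
next
  let ?g = "dual_constraint S w L r z D x0"
  fix t :: real and u v :: "real \<times> real"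
  assume t: "0 < t" "t < 1" and u: "u \<in> UNIV \<times> {0..}" and v: "v \<in> UNIV \<times> {0..}"
  obtain \<alpha>1 \<nu>1 \<alpha>2 \<nu>2 where uv: "u = (\<alpha>1, \<nu>1)" "v = (\<alpha>2, \<nu>2)" by (cases u, cases v)
  define \<alpha> where "\<alpha> = (1 - t) * \<alpha>1 + t * \<alpha>2"
  define \<nu> where "\<nu> = (1 - t) * \<nu>1 + t * \<nu>2"
  have nu: "\<nu>1 \<ge> 0" "\<nu>2 \<ge> 0" "\<nu> \<ge> 0" using u v t uv by (auto simp: \<nu>_def)
  obtain q k where q: "q \<in> distributions_on S" and k: "bootstrap_distance S q D = ereal k"
    and eq: "mean_on S (excess w L z x0 \<alpha>) q
      = log_sum_exp S (excess w L z x0 \<alpha>) D \<nu> + k * \<nu>"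
    using log_sum_exp_attained[OF fin D nu(3)] .
  define M where "M = mean_on S (excess w L z x0 0) q"
  define W where "W = (\<Sum>(x, y)\<in>S. w x x0 * pmf q (x, y))"
  define \<phi> where "\<phi> \<beta> \<mu> = M - \<beta> * W + (r - k) * \<mu>" for \<beta> \<mu>
  have below: "\<phi> \<beta> \<mu> \<le> ?g (\<beta>, \<mu>)" if "\<mu> \<ge> 0" for \<beta> \<mu>
    using mean_le_log_sum_exp[OF fin D q _ that, of k "excess w L z x0 \<beta>"] k
    unfolding dual_constraint_excess mean_on_excess[of S w L z x0 \<beta>]
    by (simp add: \<phi>_def M_def W_def algebra_simps)
  have "?g (\<alpha>, \<nu>) = \<phi> \<alpha> \<nu>"
    using eq unfolding dual_constraint_excess mean_on_excess[of S w L z x0 \<alpha>]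
    by (simp add: \<phi>_def M_def W_def algebra_simps)
  also have "\<dots> = (1 - t) * \<phi> \<alpha>1 \<nu>1 + t * \<phi> \<alpha>2 \<nu>2"
    by (simp add: \<phi>_def \<alpha>_def \<nu>_def algebra_simps)
  also have "\<dots> \<le> (1 - t) * ?g u + t * ?g v"
    using below nu t by (intro add_mono mult_left_mono) (auto simp: uv)
  finally show "?g ((1 - t) *\<^sub>R u + t *\<^sub>R v) \<le> (1 - t) * ?g u + t * ?g v"
    by (simp add: uv \<alpha>_def \<nu>_def)
qed

theorem lemma2:
  fixes data :: "('x::euclidean_space \<times> 'y::euclidean_space) list"
    and \<Omega> :: "('x \<times> 'y) set"
    and w :: "'x \<Rightarrow> 'x \<Rightarrow> real"
    and L :: "'z::euclidean_space \<Rightarrow> 'y \<Rightarrow> ereal"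
    and x0 :: 'x and r :: real and D :: "('x \<times> 'y) pmf" and zbar :: 'z
  assumes data_nonempty: "length data \<ge> 1"
    and data_in: "set data \<subseteq> \<Omega>"
    and w_pos: "\<And>x. w x x0 > 0"
    and L_nonneg: "\<And>z y. L z y \<ge> 0"
    and L_convex: "\<And>y. convex_extended (\<lambda>z. L z y)"
    and L_measurable: "\<And>z. (\<lambda>y. L z y) \<in> borel_measurable borel"
    and r_nonneg: "r \<ge> 0"
    and D_dist: "D \<in> distributions_on (set data)"
    and L_finite: "\<And>x y. (x, y) \<in> set data \<Longrightarrow> L zbar y < \<infinity>"
  shows "robust_nw_cost (set data) w L r zbar D x0 = dual_value (set data) w L r zbar D x0
    \<and> convex_on (UNIV \<times> {0..}) (dual_constraint (set data) w L r zbar D x0)"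
proof
  have "\<bar>L zbar y\<bar> \<noteq> \<infinity>" if "(x, y) \<in> set data" for x y
    using L_finite[OF that] L_nonneg[of zbar y] by (cases "L zbar y") auto
  then show "robust_nw_cost (set data) w L r zbar D x0 = dual_value (set data) w L r zbar D x0"
    using robust_nw_cost_eq_dual_value[of "set data" D w x0 L zbar r] D_dist w_pos r_nonneg by blast
  show "convex_on (UNIV \<times> {0..}) (dual_constraint (set data) w L r zbar D x0)"
    by (rule convex_on_dual_constraint) (simp_all add: D_dist)
qed

end
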